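(* Let $h_1,h_2,h_3,h_4\in\mathbb{N}$ and $v=h_1h_2h_3h_4+1$. In $\mathbb{Z}_v$ let $$A=\bigcup_{i=0}^{h_3-1}\{ih_1h_2+\alpha: 0\le\alpha\le h_1-1\},\qquad B=\bigcup_{i=0}^{h_4-1}\{ih_1h_2h_3+h_1h_2(h_3-1)+\beta h_1: 1\le\beta\le h_2\}.$$ Then $\{A,B\}$ is a classical $(v,2;h_1h_3,h_2h_4;1,1)$-GSEDF in $\mathbb{Z}_v$.
   Context: For subsets $A,B$ of an additively written group $G$, $\Delta(A,B)$ denotes the multiset $\{a-b:a\in A,b\in B\}$ (one entry per pair). For a set $S$ and $\lambda\in\mathbb{N}$, $\lambda S$ is the multiset of $\lambda$ copies of $S$. For a group $G$ of order $v$, a classical $(v,m;k_1,\dots,k_m;\lambda_1,\dots,\lambda_m)$-GSEDF is a family of pairwise disjoint sets $A_1,\dots,A_m$ in $G$ with $|A_i|=k_i$ such that for each $i$, the multiset union $\bigcup_{j\ne i}\Delta(A_i,A_j)$ equals $\lambda_i(G\setminus\{0\})$. *)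

theory Defs
  imports "HOL-Algebra.Elementary_Groups" "HOL-Library.Multiset"
begin

text \<open>
  Groups are those of HOL-Algebra, which are written multiplicatively; the difference \<open>a - b\<close> of an
  additively written group is therefore \<open>a \<otimes>\<^bsub>G\<^esub> inv\<^bsub>G\<^esub> b\<close>, and its zero is \<open>\<one>\<^bsub>G\<^esub>\<close>. Multisets built
  with \<^const>\<open>mset_set\<close> are meaningful for finite sets only; below all sets lie in a finite group.
\<close>

definition diff_mset :: "('a, 'b) monoid_scheme \<Rightarrow> 'a set \<Rightarrow> 'a set \<Rightarrow> 'a multiset" where
  "diff_mset G A B = {# a \<otimes>\<^bsub>G\<^esub> inv\<^bsub>G\<^esub> b. (a, b) \<in># mset_set (A \<times> B) #}"

text \<open>
  The family, the block sizes and the multiplicities are lists of length \<open>m\<close>, indexed from 0.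
\<close>

definition classical_GSEDF ::
  "('a, 'b) monoid_scheme \<Rightarrow> nat \<Rightarrow> nat \<Rightarrow> nat list \<Rightarrow> nat list \<Rightarrow> 'a set list \<Rightarrow> bool" where
  "classical_GSEDF G v m ks ls As \<longleftrightarrow>
     group G \<and> finite (carrier G) \<and> order G = v \<and>
     length As = m \<and> length ks = m \<and> length ls = m \<and>
     (\<forall>i<m. As ! i \<subseteq> carrier G) \<and>
     (\<forall>i<m. \<forall>j<m. i \<noteq> j \<longrightarrow> As ! i \<inter> As ! j = {}) \<and>
     (\<forall>i<m. card (As ! i) = ks ! i) \<and>
     (\<forall>i<m. (\<Sum>j\<in>{..<m} - {i}. diff_mset G (As ! i) (As ! j)) =
            repeat_mset (ls ! i) (mset_set (carrier G - {\<one>\<^bsub>G\<^esub>})))"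

end

theory Submission
  imports Defs
begin

text \<open>
  Mixed-radix expansion: as an integer, \<open>b - a - 1\<close> for \<open>a \<in> A\<close>, \<open>b \<in> B\<close> has the digits
  \<open>h\<^sub>1 - 1 - \<alpha>\<close>, \<open>\<beta> - 1\<close>, \<open>h\<^sub>3 - 1 - i\<close>, \<open>i'\<close> with respect to the radices \<open>h\<^sub>1, h\<^sub>2, h\<^sub>3, h\<^sub>4\<close>.
  Hence every integer from \<open>1\<close> to \<open>v - 1\<close> is a difference \<open>b - a\<close>. There are at most \<open>v - 1\<close> pairs
  \<open>(b, a)\<close>, so each difference occurs exactly once and the two blocks have the claimed sizes.
\<close>

lemma integer_mod_group_diff:
  assumes "v > 0" "a \<in> carrier (integer_mod_group v)" "b \<in> carrier (integer_mod_group v)"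
  shows "a \<otimes>\<^bsub>integer_mod_group v\<^esub> inv\<^bsub>integer_mod_group v\<^esub> b = (a - b) mod int v"
  using assms by (simp add: inv_integer_mod_group mod_simps)

text \<open>When every element of \<open>C\<close> is to occur exactly once, the multiset condition
  is just bijectivity of the difference map on pairs.\<close>

lemma diff_mset_eq_mset_set:
  assumes "bij_betw (\<lambda>(a, b). a \<otimes>\<^bsub>G\<^esub> inv\<^bsub>G\<^esub> b) (A \<times> B) C"
  shows "diff_mset G A B = mset_set C"
proof -
  have "diff_mset G A B = image_mset (\<lambda>(a, b). a \<otimes>\<^bsub>G\<^esub> inv\<^bsub>G\<^esub> b) (mset_set (A \<times> B))"
    by (simp add: diff_mset_def)
  then show ?thesis
    using image_mset_mset_set[of _ "A \<times> B"] assms by (metis bij_betw_def)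
qed

text \<open>One bijection over the integers gives both conditions: the values \<open>b - a\<close>
  are already reduced residues, and the opposite differences arise from them by negation mod
  \<open>v\<close>, which permutes the nonzero residues.\<close>

lemma classical_GSEDF_integer_mod_group_two_blocks:
  fixes A B :: "int set"
  assumes v: "v > 0" and A: "A \<subseteq> {0..<int v}" and B: "B \<subseteq> {0..<int v}"
    and bij: "bij_betw (\<lambda>(b, a). b - a) (B \<times> A) {1..<int v}"
  shows "classical_GSEDF (integer_mod_group v) v 2 [card A, card B] [1, 1] [A, B]"
proof -
  let ?G = "integer_mod_group v"
  have car: "carrier ?G = {0..<int v}"
    using v by (simp add: carrier_integer_mod_group)
  have mult: "a \<otimes>\<^bsub>?G\<^esub> inv\<^bsub>?G\<^esub> b = (a - b) mod int v" if "a \<in> A \<union> B" "b \<in> A \<union> B" for a b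
    using that v A B car by (intro integer_mod_group_diff) auto
  have range: "b - a \<in> {1..<int v}" if "a \<in> A" "b \<in> B" for a b
    using bij_betwE[OF bij] that by auto
  have "bij_betw (\<lambda>(b, a). b \<otimes>\<^bsub>?G\<^esub> inv\<^bsub>?G\<^esub> a) (B \<times> A) {1..<int v}"
    using bij
  proof (rule bij_betw_cong[THEN iffD2, rotated])
    fix p assume "p \<in> B \<times> A"
    then obtain b a where p: "p = (b, a)" "b \<in> B" "a \<in> A" by auto
    then show "(\<lambda>(b, a). b \<otimes>\<^bsub>?G\<^esub> inv\<^bsub>?G\<^esub> a) p = (\<lambda>(b, a). b - a) p"
      using mult[of b a] range[of a b] by simp
  qed
  then have BA: "diff_mset ?G B A = mset_set {1..<int v}"
    by (rule diff_mset_eq_mset_set)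
  have swap: "bij_betw prod.swap (A \<times> B) (B \<times> A)"
    by (auto simp: bij_betw_def product_swap)
  \<comment> \<open>Negation of nonzero residues, written on representatives.\<close>
  have refl: "bij_betw (\<lambda>x. int v - x) {1..<int v} {1..<int v}"
    by (rule bij_betw_byWitness[where f' = "\<lambda>x. int v - x"]) auto
  have "bij_betw ((\<lambda>x. int v - x) \<circ> ((\<lambda>(b, a). b - a) \<circ> prod.swap)) (A \<times> B) {1..<int v}"
    using bij_betw_trans[OF bij_betw_trans[OF swap bij] refl] .
  then have "bij_betw (\<lambda>(a, b). a \<otimes>\<^bsub>?G\<^esub> inv\<^bsub>?G\<^esub> b) (A \<times> B) {1..<int v}"
  proof (rule bij_betw_cong[THEN iffD2, rotated])
    fix p assume "p \<in> A \<times> B"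
    then obtain a b where p: "p = (a, b)" "a \<in> A" "b \<in> B" by auto
    have "(a - b) mod int v = (int v - (b - a)) mod int v"
      using mod_add_self1[of "int v" "a - b"] by (simp add: algebra_simps)
    also have "\<dots> = int v - (b - a)"
      using range[OF p(2,3)] by (intro mod_pos_pos_trivial) auto
    finally show "(\<lambda>(a, b). a \<otimes>\<^bsub>?G\<^esub> inv\<^bsub>?G\<^esub> b) p
        = ((\<lambda>x. int v - x) \<circ> ((\<lambda>(b, a). b - a) \<circ> prod.swap)) p"
      using p mult[of a b] by simp
  qed
  then have AB: "diff_mset ?G A B = mset_set {1..<int v}"
    by (rule diff_mset_eq_mset_set)
  have nz: "carrier ?G - {\<one>\<^bsub>?G\<^esub>} = {1..<int v}"
    unfolding car by auto
  \<comment> \<open>A common element would give the difference 0, which \<open>range\<close>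
    excludes.\<close>
  have disj: "A \<inter> B = {}"
    using range by force
  have two: "{..<2::nat} - {0} = {1}" "{..<2::nat} - {Suc 0} = {0}"
    by auto
  have all2: "(\<forall>i<2. P i) \<longleftrightarrow> P 0 \<and> P 1" for P :: "nat \<Rightarrow> bool"
    by (auto simp: less_2_cases_iff)
  have "order ?G = v"
    by (simp add: order_def car)
  then show ?thesis
    unfolding classical_GSEDF_def nz all2
    using car disj A B AB BA two by (simp add: Int_commute)
qed

theorem theorem6p1:
  fixes h1 h2 h3 h4 v :: nat and A B :: "int set"
  assumes "h1 \<ge> 1" and "h2 \<ge> 1" and "h3 \<ge> 1" and "h4 \<ge> 1"
    and "v = h1 * h2 * h3 * h4 + 1"
    and "A = (\<Union>i\<in>{0..int h3 - 1}.
               {(i * int h1 * int h2 + \<alpha>) mod int v | \<alpha>. 0 \<le> \<alpha> \<and> \<alpha> \<le> int h1 - 1})"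
    and "B = (\<Union>i\<in>{0..int h4 - 1}.
               {(i * int h1 * int h2 * int h3 + int h1 * int h2 * (int h3 - 1) + \<beta> * int h1) mod int v
                | \<beta>. 1 \<le> \<beta> \<and> \<beta> \<le> int h2})"
  shows "classical_GSEDF (integer_mod_group v) v 2 [h1 * h3, h2 * h4] [1, 1] [A, B]"
proof -
  define p q r s where pqrs: "p = int h1" "q = int h2" "r = int h3" "s = int h4"
  have pos: "p \<ge> 1" "q \<ge> 1" "r \<ge> 1" "s \<ge> 1"
    using assms pqrs by auto
  have v: "int v = p * q * r * s + 1"
    using assms pqrs by simp
  \<comment> \<open>\<open>f\<close> and \<open>g\<close> give the elements of the blocks before
    reduction mod \<open>v\<close>. The two range facts below show that reduction changes nothing,
    so \<open>A\<close> and \<open>B\<close> can be treated as plain sets of integers.\<close>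
  define f where "f = (\<lambda>(i, \<alpha>). i * p * q + \<alpha>)"
  define g where "g = (\<lambda>(i, \<beta>). i * p * q * r + p * q * (r - 1) + \<beta> * p)"
  let ?I = "{0..r - 1} \<times> {0..p - 1}" and ?J = "{0..s - 1} \<times> {1..q}"
  have f_range: "f x \<in> {0..<int v}" if x: "x \<in> ?I" for x
  proof -
    obtain i \<alpha> where [simp]: "x = (i, \<alpha>)" by fastforce
    have "i * (p * q) \<le> (r - 1) * (p * q)" "p * 1 \<le> p * q" "p * q * r * 1 \<le> p * q * r * s" "0 \<le> i * (p * q)"
      using x pos by (auto intro!: mult_right_mono mult_left_mono)
    moreover have "(r - 1) * (p * q) = p * q * r - p * q" by (simp add: algebra_simps)
    moreover have "0 \<le> \<alpha>" "\<alpha> \<le> p - 1" using x by auto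
    ultimately have "0 \<le> i * (p * q) + \<alpha>" "i * (p * q) + \<alpha> < p * q * r * s + 1" by linarith+
    then show ?thesis unfolding v f_def by (simp add: mult.assoc)
  qed
  have g_range: "g x \<in> {0..<int v}" if x: "x \<in> ?J" for x
  proof -
    obtain i \<beta> where [simp]: "x = (i, \<beta>)" by fastforce
    have "i * (p * q * r) \<le> (s - 1) * (p * q * r)" "\<beta> * p \<le> q * p"
      "0 \<le> i * (p * q * r)" "0 \<le> p * q * (r - 1)" "0 \<le> \<beta> * p"
      using x pos by (auto intro!: mult_right_mono mult_left_mono)
    \<comment> \<open>The bound is tight: \<open>i = s - 1\<close> and \<open>\<beta> = q\<close>
      give exactly \<open>v - 1\<close>.\<close>
    moreover have "(s - 1) * (p * q * r) + p * q * (r - 1) + q * p = p * q * r * s"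
      by (simp add: algebra_simps)
    ultimately show ?thesis using x unfolding v g_def by (simp add: mult.assoc)
  qed
  have image_pairs: "(\<Union>i\<in>I. {F (i, b) | b. P b}) = F ` (I \<times> {b. P b})"
    for I :: "int set" and F :: "int \<times> int \<Rightarrow> int" and P
    by auto
  have "A = (\<lambda>x. f x mod int v) ` ?I"
    using image_pairs[where I = "{0..r - 1}" and F = "\<lambda>x. f x mod int v"
        and P = "\<lambda>\<alpha>. 0 \<le> \<alpha> \<and> \<alpha> \<le> p - 1"]
    by (simp add: assms(6) f_def pqrs atLeastAtMost_def atLeast_def atMost_def Collect_conj_eq)
  also have "\<dots> = f ` ?I"
    using f_range by (intro image_cong) auto
  finally have A: "A = f ` ?I" .
  have "B = (\<lambda>x. g x mod int v) ` ?J"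
    using image_pairs[where I = "{0..s - 1}" and F = "\<lambda>x. g x mod int v"
        and P = "\<lambda>\<beta>. 1 \<le> \<beta> \<and> \<beta> \<le> q"]
    by (simp add: assms(7) g_def pqrs atLeastAtMost_def atLeast_def atMost_def Collect_conj_eq)
  also have "\<dots> = g ` ?J"
    using g_range by (intro image_cong) auto
  finally have B: "B = g ` ?J" .
  have fin: "finite A" "finite B" by (simp_all add: A B)
  have surj: "{1..<int v} \<subseteq> (\<lambda>(b, a). b - a) ` (B \<times> A)"
  proof
    fix x assume x: "x \<in> {1..<int v}"
    define y where "y = x - 1"
    define d0 where "d0 = y mod p"
    define d1 where "d1 = y div p mod q"
    define d2 where "d2 = y div p div q mod r"
    define d3 where "d3 = y div p div q div r"
    have y: "y = ((d3 * r + d2) * q + d1) * p + d0"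
      by (simp add: d0_def d1_def d2_def d3_def)
    have y_range: "0 \<le> y" "y < p * q * r * s" using x v y_def by auto
    have d: "d0 \<in> {0..p - 1}" "d1 \<in> {0..q - 1}" "d2 \<in> {0..r - 1}"
      using pos by (auto simp: d0_def d1_def d2_def)
    have m: "p * q * r > 0"
      using pos by (intro mult_pos_pos) auto
    \<comment> \<open>The leading digit is not reduced mod \<open>s\<close>; its bound has to come
      from \<open>y < p * q * r * s\<close>.\<close>
    have "d3 = y div (p * q * r)"
      using pos by (simp add: d3_def zdiv_zmult2_eq)
    moreover have "y div (p * q * r) < s"
    proof (rule ccontr)
      assume "\<not> y div (p * q * r) < s"
      then have "s * (p * q * r) \<le> y div (p * q * r) * (p * q * r)"
        using m by (intro mult_right_mono) auto
      also have "\<dots> \<le> y"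
        using m minus_mod_eq_div_mult[of y "p * q * r"] pos_mod_sign[of "p * q * r" y] by linarith
      finally show False
        using y_range(2) by (simp add: ac_simps)
    qed
    ultimately have d3: "d3 \<in> {0..s - 1}"
      using y_range m by (simp add: pos_imp_zdiv_nonneg_iff)
    \<comment> \<open>The digits \<open>d2\<close> and \<open>d0\<close> enter \<open>f\<close>
      complemented: subtracting from the summands \<open>p * q * (r - 1)\<close> and
      \<open>p\<close> of \<open>g\<close> restores them without a borrow, and leaves the extra
      1.\<close>
    have "g (d3, d1 + 1) - f (r - 1 - d2, p - 1 - d0) = y + 1"
      unfolding y f_def g_def by (simp add: algebra_simps)
    moreover have "g (d3, d1 + 1) \<in> B" "f (r - 1 - d2, p - 1 - d0) \<in> A"
      unfolding A B using d d3 by auto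
    ultimately show "x \<in> (\<lambda>(b, a). b - a) ` (B \<times> A)"
      unfolding y_def by force
  qed
  \<comment> \<open>Injectivity of \<open>f\<close> and \<open>g\<close> is not proved directly.
    These upper bounds, together with surjectivity of the difference map, force equality.\<close>
  have "card A \<le> card ?I" "card B \<le> card ?J"
    unfolding A B by (rule card_image_le; simp)+
  then have card_le: "card A \<le> h1 * h3" "card B \<le> h2 * h4"
    by (simp_all add: pqrs card_cartesian_product mult.commute)
  have "int v = 1 + int (h1 * h3 * (h2 * h4))"
    using assms(5) by simp
  then have card_v: "card {1..<int v} = h1 * h3 * (h2 * h4)"
    by (simp del: of_nat_mult)
  have "card {1..<int v} \<le> card ((\<lambda>(b, a). b - a) ` (B \<times> A))"
    using surj fin by (intro card_mono) auto
  then have *: "h1 * h3 * (h2 * h4) \<le> card ((\<lambda>(b, a). b - a) ` (B \<times> A))"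
    by (simp only: card_v)
  also have "\<dots> \<le> card (B \<times> A)"
    using fin by (intro card_image_le) auto
  also have "card (B \<times> A) = card A * card B"
    by (simp add: card_cartesian_product)
  finally have ge: "h1 * h3 * (h2 * h4) \<le> card A * card B" .
  have cA: "card A = h1 * h3"
  proof (rule antisym)
    \<comment> \<open>The positive factor \<open>h2 * h4\<close> is then cancelled.\<close>
    have "h1 * h3 * (h2 * h4) \<le> card A * (h2 * h4)"
      by (rule order_trans[OF ge mult_left_mono[OF card_le(2)]]) simp
    then show "h1 * h3 \<le> card A"
      using assms(2,4) by simp
  qed (rule card_le)
  have cB: "card B = h2 * h4"
    using ge card_le(2) assms(1,3) by (simp add: cA)
  have inj: "inj_on (\<lambda>(b, a). b - a) (B \<times> A)"
  proof (rule eq_card_imp_inj_on)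
    show "card ((\<lambda>(b, a). b - a) ` (B \<times> A)) = card (B \<times> A)"
      using * fin cA cB by (intro antisym card_image_le) (auto simp: ac_simps)
  qed (use fin in simp)
  \<comment> \<open>Equal cardinalities also rule out differences outside the interval, so no
    separate check that \<open>b - a\<close> is positive and below \<open>v\<close> is made.\<close>
  have "{1..<int v} = (\<lambda>(b, a). b - a) ` (B \<times> A)"
  proof (rule card_subset_eq[OF _ surj])
    show "card {1..<int v} = card ((\<lambda>(b, a). b - a) ` (B \<times> A))"
      using card_image[OF inj] cA cB card_v by (simp add: card_cartesian_product ac_simps)
  qed (use fin in simp)
  then have bij: "bij_betw (\<lambda>(b, a). b - a) (B \<times> A) {1..<int v}"
    using inj by (simp add: bij_betw_def)
  have "v > 0" "A \<subseteq> {0..<int v}" "B \<subseteq> {0..<int v}"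
    unfolding A B using f_range g_range by (simp add: assms(5), blast+)
  from classical_GSEDF_integer_mod_group_two_blocks[OF this bij]
  show ?thesis by (simp add: cA cB)
qed

end
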